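(* Let $\star$ be a semistar operation on an integral domain $D$, and let $I$ be a nonzero fractional ideal of $D$. (1) If $\star$ is a (semi)star operation, then $I$ is quasi-$\star$-invertible if and only if $I$ is $\star$-invertible. (2) If $\star$ is stable and $I$ is finitely generated, then $I$ is quasi-$\star$-invertible if and only if $I$ is $\star$-invertible.
   Context: Let $D$ be an integral domain with quotient field $K$; $\overline{F}(D)$ is the set of nonzero $D$-submodules of $K$. A semistar operation on $D$ is a map $\star:\overline{F}(D)\to\overline{F}(D)$, $E\mapsto E^\star$, such that for all $0\ne x\in K$ and $E,F\in\overline{F}(D)$: $(xE)^\star=xE^\star$; $E\subseteq F$ implies $E^\star\subseteq F^\star$; $E\subseteq E^\star$ and $(E^\star)^\star=E^\star$. It is called a (semi)star operation if $D^\star=D$. It is called stable if $(E\cap F)^\star=E^\star\cap F^\star$ for all $E,F\in\overline{F}(D)$. For $E,F\in\overline{F}(D)$, $(E:F)=\{z\in K: zF\subseteq E\}$, and $I^{-1}=(D:I)$. A nonzero fractional ideal $I$ of $D$ is $\star$-invertible if $(II^{-1})^\star=D^\star$. An element $I\in\overline{F}(D)$ is quasi-$\star$-invertible if $(I(D^\star:I))^\star=D^\star$. *)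

theory Defs
  imports "HOL-Computational_Algebra.Polynomial_Factorial"
begin

text \<open>
  The integral domain \<open>D\<close> is the type \<open>'a :: idom\<close>, its quotient field \<open>K\<close> is the library's
  field of fractions \<open>'a fract\<close>, and \<open>D\<close> sits in \<open>K\<close> as the set \<open>base_domain = range to_fract\<close>.
\<close>

abbreviation base_domain :: "'a::idom fract set"
  where "base_domain \<equiv> range to_fract"

definition fract_scale :: "'a::idom \<Rightarrow> 'a fract \<Rightarrow> 'a fract"
  where "fract_scale d x = to_fract d * x"

interpretation fract_module: module "fract_scale :: 'a::idom \<Rightarrow> 'a fract \<Rightarrow> 'a fract"
  by unfold_locales (simp_all add: fract_scale_def algebra_simps)

definition Fbar :: "'a::idom fract set set"
  where "Fbar = {E. fract_module.subspace E \<and> E \<noteq> {0}}"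

definition module_prod :: "'a::idom fract set \<Rightarrow> 'a fract set \<Rightarrow> 'a fract set"
  where "module_prod E F = fract_module.span {x * y | x y. x \<in> E \<and> y \<in> F}"

definition module_colon :: "'a::idom fract set \<Rightarrow> 'a fract set \<Rightarrow> 'a fract set"
  where "module_colon E F = {z. (\<lambda>x. z * x) ` F \<subseteq> E}"

definition module_inverse :: "'a::idom fract set \<Rightarrow> 'a fract set"
  where "module_inverse I = module_colon base_domain I"

definition nonzero_fractional_ideal :: "'a::idom fract set \<Rightarrow> bool"
  where "nonzero_fractional_ideal I \<longleftrightarrow>
    I \<in> Fbar \<and> (\<exists>d::'a. d \<noteq> 0 \<and> fract_scale d ` I \<subseteq> base_domain)"

definition finitely_generated :: "'a::idom fract set \<Rightarrow> bool"
  where "finitely_generated E \<longleftrightarrow> (\<exists>S. finite S \<and> E = fract_module.span S)"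

text \<open>
  A semistar operation is represented by a total function on sets; its values outside
  \<^term>\<open>Fbar\<close> are unconstrained, so every definition below applies it only to members of
  \<^term>\<open>Fbar\<close>. (The intersection of two members of \<^term>\<open>Fbar\<close> is again one, as any two nonzero
  fractions have a common nonzero multiple.)
\<close>

definition semistar_operation :: "('a::idom fract set \<Rightarrow> 'a fract set) \<Rightarrow> bool"
  where "semistar_operation star \<longleftrightarrow>
    (\<forall>E\<in>Fbar. star E \<in> Fbar) \<and>
    (\<forall>x E. x \<noteq> 0 \<and> E \<in> Fbar \<longrightarrow> star ((\<lambda>y. x * y) ` E) = (\<lambda>y. x * y) ` star E) \<and>
    (\<forall>E\<in>Fbar. \<forall>F\<in>Fbar. E \<subseteq> F \<longrightarrow> star E \<subseteq> star F) \<and>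
    (\<forall>E\<in>Fbar. E \<subseteq> star E \<and> star (star E) = star E)"

text \<open>The ``(semi)star'' operations, to be distinguished from the semistar operations above:\<close>

definition semi_star_operation :: "('a::idom fract set \<Rightarrow> 'a fract set) \<Rightarrow> bool"
  where "semi_star_operation star \<longleftrightarrow>
    semistar_operation star \<and> star base_domain = base_domain"

definition stable_semistar :: "('a::idom fract set \<Rightarrow> 'a fract set) \<Rightarrow> bool"
  where "stable_semistar star \<longleftrightarrow>
    semistar_operation star \<and> (\<forall>E\<in>Fbar. \<forall>F\<in>Fbar. star (E \<inter> F) = star E \<inter> star F)"

definition star_invertible ::
    "('a::idom fract set \<Rightarrow> 'a fract set) \<Rightarrow> 'a fract set \<Rightarrow> bool"
  where "star_invertible star I \<longleftrightarrow>
    nonzero_fractional_ideal I \<and>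
    star (module_prod I (module_inverse I)) = star base_domain"

text \<open>
  For general \<open>I \<in> Fbar\<close> the colon module \<open>(D\<^sup>\<star> : I)\<close> may be zero, and then \<open>\<star>\<close> is not
  defined on \<open>I (D\<^sup>\<star> : I)\<close>; the middle conjunct makes such \<open>I\<close> not quasi-invertible. It holds
  automatically when \<open>I\<close> is a nonzero fractional ideal.
\<close>

definition quasi_star_invertible ::
    "('a::idom fract set \<Rightarrow> 'a fract set) \<Rightarrow> 'a fract set \<Rightarrow> bool"
  where "quasi_star_invertible star I \<longleftrightarrow>
    I \<in> Fbar \<and>
    module_prod I (module_colon (star base_domain) I) \<in> Fbar \<and>
    star (module_prod I (module_colon (star base_domain) I)) = star base_domain"

end

theory Submission
  imports Defs
begin

text \<open>
  Both equivalences compare \<open>I (D\<^sup>\<star> : I)\<close> with \<open>I (D : I)\<close> after applying \<open>\<star>\<close>. For a (semi)star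
  operation \<open>D\<^sup>\<star> = D\<close>, so the two products are the same.

  In the stable case, let \<open>I\<close> be generated by finitely many nonzero \<open>x\<^sub>1, \<dots>, x\<^sub>n\<close>. Then
  \<open>(E : I)\<close> is the finite intersection of the modules \<open>x\<^sub>i\<^sup>-\<^sup>1 E\<close>. A semistar operation commutes with
  scaling, and a stable one also with finite intersections, whence \<open>(E : I)\<^sup>\<star> = (E\<^sup>\<star> : I)\<close>
  (\<open>stable_star_colon\<close>). So \<open>(D\<^sup>\<star> : I)\<close> is the closure of \<open>J = (D : I)\<close>, and a closure inside a
  product is absorbed by an outer one: \<open>(I J\<^sup>\<star>)\<^sup>\<star> = (I J)\<^sup>\<star>\<close> (\<open>star_module_prod_star\<close>).
  The condition that \<open>I\<close> is a fractional ideal ensures that \<open>(D : I)\<close> is nonzero, so that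
  \<open>\<star>\<close> can be applied to it.
\<close>

lemma subspace_fract_iff:
  "fract_module.subspace E \<longleftrightarrow>
    0 \<in> E \<and> (\<forall>x\<in>E. \<forall>y\<in>E. x + y \<in> E) \<and> (\<forall>c. \<forall>x\<in>E. to_fract c * x \<in> E)"
  by (auto simp: fract_module.subspace_def fract_scale_def)

lemma Fbar_iff: "E \<in> Fbar \<longleftrightarrow> fract_module.subspace E \<and> (\<exists>x\<in>E. x \<noteq> 0)"
  by (auto simp: Fbar_def dest: fract_module.subspace_0)

lemma FbarI: "fract_module.subspace E \<Longrightarrow> x \<in> E \<Longrightarrow> x \<noteq> 0 \<Longrightarrow> E \<in> Fbar"
  by (auto simp: Fbar_iff)

lemma FbarD_subspace: "E \<in> Fbar \<Longrightarrow> fract_module.subspace E"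
  by (simp add: Fbar_iff)

lemma Fbar_mono:
  assumes "E \<in> Fbar" "E \<subseteq> F" "fract_module.subspace F"
  shows "F \<in> Fbar"
  using assms by (auto simp: Fbar_iff)

lemma base_domain_Fbar: "base_domain \<in> Fbar"
  unfolding Fbar_iff subspace_fract_iff
proof (intro conjI ballI allI)
  show "(0::'a fract) \<in> base_domain" by (metis rangeI to_fract_0)
  show "\<exists>x\<in>(base_domain::'a fract set). x \<noteq> 0" by (metis rangeI to_fract_1 zero_neq_one)
qed (auto simp flip: to_fract_add to_fract_mult)

lemma Fbar_scale:
  assumes "E \<in> Fbar" "x \<noteq> 0"
  shows "(\<lambda>y. x * y) ` E \<in> Fbar"
proof -
  have "fract_module.subspace ((\<lambda>y. x * y) ` E)"
    unfolding subspace_fract_iff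
  proof (intro conjI ballI allI)
    note E = FbarD_subspace[OF assms(1), unfolded subspace_fract_iff]
    show "0 \<in> (\<lambda>y. x * y) ` E"
      using E by (intro rev_image_eqI[of 0]) auto
    show "u + v \<in> (\<lambda>y. x * y) ` E" if "u \<in> (\<lambda>y. x * y) ` E" "v \<in> (\<lambda>y. x * y) ` E" for u v
      using that E by (auto simp flip: distrib_left)
    show "to_fract c * u \<in> (\<lambda>y. x * y) ` E" if "u \<in> (\<lambda>y. x * y) ` E" for c u
      using that E by (auto simp: mult.left_commute[of _ x])
  qed
  then show ?thesis
    using assms by (auto simp: Fbar_iff)
qed

text \<open>Clearing the denominator of a nonzero element leaves a nonzero element of \<open>D\<close>.\<close>

lemma Fbar_meets_base_domain:
  assumes "E \<in> Fbar"
  obtains d where "d \<noteq> 0" "to_fract d \<in> E"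
proof -
  obtain x where x: "x \<in> E" "x \<noteq> 0" using assms by (auto simp: Fbar_iff)
  obtain p q where pq: "x = Fract p q" "q \<noteq> 0" by (cases x) auto
  have "to_fract q * x = to_fract p"
    using pq by (simp add: to_fract_def eq_fract mult.commute)
  then have "to_fract p \<in> E"
    using x(1) FbarD_subspace[OF assms] unfolding subspace_fract_iff by metis
  moreover have "p \<noteq> 0" using x(2) pq by (auto simp: Zero_fract_def eq_fract)
  ultimately show thesis using that by blast
qed

lemma Fbar_Int:
  assumes "E \<in> Fbar" "F \<in> Fbar"
  shows "E \<inter> F \<in> Fbar"
proof -
  obtain d where d: "d \<noteq> 0" "to_fract d \<in> E" using Fbar_meets_base_domain[OF assms(1)] .
  obtain e where e: "e \<noteq> 0" "to_fract e \<in> F" using Fbar_meets_base_domain[OF assms(2)] .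
  have "to_fract (e * d) \<in> E"
    using d assms(1) by (simp add: Fbar_iff subspace_fract_iff)
  moreover have "to_fract (e * d) \<in> F"
    using e assms(2) by (simp add: Fbar_iff subspace_fract_iff mult.commute[of e])
  moreover have "to_fract (e * d) \<noteq> 0" using d e by simp
  ultimately show ?thesis
    using fract_module.subspace_inter[OF assms[THEN FbarD_subspace]] by (blast intro: FbarI)
qed

lemma module_prod_Fbar:
  assumes "E \<in> Fbar" "F \<in> Fbar"
  shows "module_prod E F \<in> Fbar"
proof -
  obtain x y where "x \<in> E" "y \<in> F" "x \<noteq> 0" "y \<noteq> 0"
    using assms by (auto simp: Fbar_iff)
  then have "x * y \<in> module_prod E F" and "x * y \<noteq> 0"
    unfolding module_prod_def by (auto intro!: fract_module.span_base)
  moreover have "fract_module.subspace (module_prod E F)"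
    by (simp add: module_prod_def)
  ultimately show ?thesis by (blast intro: FbarI)
qed

lemma module_prod_mono: "F \<subseteq> G \<Longrightarrow> module_prod E F \<subseteq> module_prod E G"
  unfolding module_prod_def by (rule fract_module.span_mono) auto

lemma module_colon_iff: "z \<in> module_colon E F \<longleftrightarrow> (\<forall>x\<in>F. z * x \<in> E)"
  by (auto simp: module_colon_def)

lemma module_colon_mono: "E \<subseteq> F \<Longrightarrow> module_colon E I \<subseteq> module_colon F I"
  unfolding module_colon_def by blast

lemma subspace_module_colon:
  assumes "fract_module.subspace E"
  shows "fract_module.subspace (module_colon E F)"
  using assms by (simp add: subspace_fract_iff module_colon_iff distrib_right mult.assoc)

lemma module_colon_span:
  assumes E: "fract_module.subspace E"
  shows "module_colon E (fract_module.span S) = module_colon E S"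
proof (intro subset_antisym subsetI)
  fix z assume z: "z \<in> module_colon E S"
  have "fract_module.subspace {x. z * x \<in> E}"
    using E by (simp add: subspace_fract_iff distrib_left mult.left_commute[of z])
  then have "fract_module.span S \<subseteq> {x. z * x \<in> E}"
    using z by (intro fract_module.span_minimal) (auto simp: module_colon_iff)
  then show "z \<in> module_colon E (fract_module.span S)"
    by (auto simp: module_colon_iff)
qed (auto simp: module_colon_iff fract_module.span_base)

lemma module_colon_insert:
  assumes "x \<noteq> 0"
  shows "module_colon E (insert x S) = (\<lambda>y. inverse x * y) ` E \<inter> module_colon E S"
proof -
  have "z * x \<in> E \<longleftrightarrow> z \<in> (\<lambda>y. inverse x * y) ` E" for z
  proof
    assume "z * x \<in> E"
    moreover have "z = inverse x * (z * x)" using assms by simp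
    ultimately show "z \<in> (\<lambda>y. inverse x * y) ` E" by (rule rev_image_eqI)
  next
    assume "z \<in> (\<lambda>y. inverse x * y) ` E"
    then show "z * x \<in> E" using assms by (auto simp: mult.commute[of _ x] simp flip: mult.assoc)
  qed
  then show ?thesis by (auto simp: module_colon_iff)
qed

lemma module_colon_Diff_zero: "0 \<in> E \<Longrightarrow> module_colon E (S - {0}) = module_colon E S"
  by (intro set_eqI) (metis Diff_iff module_colon_iff mult_zero_right singletonD)

lemma module_inverse_Fbar:
  assumes "nonzero_fractional_ideal I"
  shows "module_inverse I \<in> Fbar"
proof -
  obtain d where d: "d \<noteq> 0" "fract_scale d ` I \<subseteq> base_domain"
    using assms by (auto simp: nonzero_fractional_ideal_def)
  then have "to_fract d \<in> module_inverse I"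
    by (auto simp: module_inverse_def module_colon_iff fract_scale_def)
  moreover have "to_fract d \<noteq> 0" using d by simp
  moreover have "fract_module.subspace (module_inverse I)"
    unfolding module_inverse_def
    by (intro subspace_module_colon FbarD_subspace base_domain_Fbar)
  ultimately show ?thesis by (blast intro: FbarI)
qed

context
  fixes star :: "'a::idom fract set \<Rightarrow> 'a fract set"
  assumes semistar: "semistar_operation star"
begin

lemma star_Fbar: "E \<in> Fbar \<Longrightarrow> star E \<in> Fbar"
  using semistar by (simp add: semistar_operation_def)

lemma star_scale:
  "x \<noteq> 0 \<Longrightarrow> E \<in> Fbar \<Longrightarrow> star ((\<lambda>y. x * y) ` E) = (\<lambda>y. x * y) ` star E"
  using semistar by (simp add: semistar_operation_def)

lemma star_mono: "E \<in> Fbar \<Longrightarrow> F \<in> Fbar \<Longrightarrow> E \<subseteq> F \<Longrightarrow> star E \<subseteq> star F"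
  using semistar by (simp add: semistar_operation_def)

lemma star_extensive: "E \<in> Fbar \<Longrightarrow> E \<subseteq> star E"
  using semistar by (simp add: semistar_operation_def)

lemma star_idem: "E \<in> Fbar \<Longrightarrow> star (star E) = star E"
  using semistar by (simp add: semistar_operation_def)

text \<open>
  For nonzero \<open>x \<in> E\<close>, \<open>x F\<^sup>\<star> = (x F)\<^sup>\<star> \<subseteq> (E F)\<^sup>\<star>\<close>; as \<open>(E F)\<^sup>\<star>\<close> is a module, it contains all of
  \<open>E F\<^sup>\<star>\<close>, and idempotence gives the nontrivial inclusion.
\<close>

lemma star_module_prod_star:
  assumes E: "E \<in> Fbar" and F: "F \<in> Fbar"
  shows "star (module_prod E (star F)) = star (module_prod E F)"
proof
  have EF: "module_prod E F \<in> Fbar" and EsF: "module_prod E (star F) \<in> Fbar"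
    using E F by (simp_all add: module_prod_Fbar star_Fbar)
  have sub: "fract_module.subspace (star (module_prod E F))"
    using EF by (simp add: star_Fbar FbarD_subspace)
  have "x * y \<in> star (module_prod E F)" if x: "x \<in> E" and y: "y \<in> star F" for x y
  proof (cases "x = 0")
    case True
    then show ?thesis using sub by (simp add: fract_module.subspace_0)
  next
    case False
    have "(\<lambda>y. x * y) ` F \<subseteq> module_prod E F"
      using x by (auto simp: module_prod_def intro!: fract_module.span_base)
    then have "star ((\<lambda>y. x * y) ` F) \<subseteq> star (module_prod E F)"
      using EF F False by (intro star_mono Fbar_scale)
    then show ?thesis using y F False by (auto simp: star_scale)
  qed
  then have "module_prod E (star F) \<subseteq> star (module_prod E F)"
    unfolding module_prod_def[of E "star F"]
    by (intro fract_module.span_minimal[OF _ sub]) auto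
  then have "star (module_prod E (star F)) \<subseteq> star (star (module_prod E F))"
    using EF EsF by (intro star_mono star_Fbar)
  then show "star (module_prod E (star F)) \<subseteq> star (module_prod E F)"
    using EF by (simp add: star_idem)
  show "star (module_prod E F) \<subseteq> star (module_prod E (star F))"
    using EF EsF F by (intro star_mono module_prod_mono star_extensive)
qed

text \<open>
  Membership in \<^term>\<open>Fbar\<close> is carried through the induction, because stability speaks only about
  intersections of two nonzero modules.
\<close>

lemma stable_star_colon_finite:
  assumes stable: "stable_semistar star" and E: "E \<in> Fbar"
    and "finite S" "S \<noteq> {}" "0 \<notin> S"
  shows "module_colon E S \<in> Fbar \<and> star (module_colon E S) = module_colon (star E) S"
  using \<open>finite S\<close> \<open>S \<noteq> {}\<close> \<open>0 \<notin> S\<close>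
proof (induction S rule: finite_ne_induct)
  case (singleton x)
  have "module_colon G {x} = (\<lambda>y. inverse x * y) ` G" for G
    using singleton module_colon_insert[of x G "{}"] by (simp add: module_colon_def)
  then show ?case
    using singleton E by (simp add: Fbar_scale star_scale)
next
  case (insert x S)
  then have IH: "module_colon E S \<in> Fbar" "star (module_colon E S) = module_colon (star E) S"
    and x: "x \<noteq> 0" by auto
  have xE: "(\<lambda>y. inverse x * y) ` E \<in> Fbar"
    using E x by (simp add: Fbar_scale)
  have "star ((\<lambda>y. inverse x * y) ` E \<inter> module_colon E S) =
      (\<lambda>y. inverse x * y) ` star E \<inter> module_colon (star E) S"
    using stable xE IH E x by (simp add: stable_semistar_def star_scale)
  then show ?case
    using xE IH x by (simp add: module_colon_insert Fbar_Int)
qed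

lemma stable_star_colon:
  assumes "stable_semistar star" and E: "E \<in> Fbar"
    and I: "I \<in> Fbar" "finitely_generated I"
  shows "star (module_colon E I) = module_colon (star E) I"
proof -
  obtain S where S: "finite S" "I = fract_module.span S"
    using I(2) by (auto simp: finitely_generated_def)
  \<comment> \<open>A zero generator imposes no condition on the colon module, but has no inverse to scale by.\<close>
  have reduce: "module_colon G I = module_colon G (S - {0})" if "G \<in> Fbar" for G
    using FbarD_subspace[OF that] S(2)
    by (simp add: module_colon_span module_colon_Diff_zero fract_module.subspace_0)
  have "S - {0} \<noteq> {}"
  proof
    assume "S - {0} = {}"
    then have "I \<subseteq> {0}"
      unfolding S(2) by (intro fract_module.span_minimal) auto
    then show False using I(1) by (auto simp: Fbar_iff)
  qed
  then show ?thesis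
    using stable_star_colon_finite[OF assms(1) E, of "S - {0}"] S(1) E
    by (simp add: reduce star_Fbar)
qed

text \<open>
  The equality of closures is all that separates the two notions: nonzeroness of
  \<open>I (D\<^sup>\<star> : I)\<close> is inherited from \<open>I (D : I)\<close>.
\<close>

lemma quasi_star_invertible_iff_star_invertible:
  assumes I: "nonzero_fractional_ideal I"
    and eq: "star (module_prod I (module_colon (star base_domain) I)) =
      star (module_prod I (module_inverse I))"
  shows "quasi_star_invertible star I \<longleftrightarrow> star_invertible star I"
proof -
  have IF: "I \<in> Fbar" using I by (simp add: nonzero_fractional_ideal_def)
  have "module_inverse I \<subseteq> module_colon (star base_domain) I"
    unfolding module_inverse_def
    by (rule module_colon_mono[OF star_extensive[OF base_domain_Fbar]])
  moreover have "fract_module.subspace (module_colon (star base_domain) I)"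
    by (rule subspace_module_colon[OF FbarD_subspace[OF star_Fbar[OF base_domain_Fbar]]])
  ultimately have "module_colon (star base_domain) I \<in> Fbar"
    using Fbar_mono[OF module_inverse_Fbar[OF I]] by metis
  then show ?thesis
    using I IF eq by (simp add: quasi_star_invertible_def star_invertible_def module_prod_Fbar)
qed

end

theorem corollary2p17:
  fixes star :: "'a::idom fract set \<Rightarrow> 'a fract set" and I :: "'a fract set"
  assumes "semistar_operation star"
    and "nonzero_fractional_ideal I"
  shows "(semi_star_operation star \<longrightarrow>
           (quasi_star_invertible star I \<longleftrightarrow> star_invertible star I)) \<and>
         (stable_semistar star \<and> finitely_generated I \<longrightarrow>
           (quasi_star_invertible star I \<longleftrightarrow> star_invertible star I))"
proof (intro conjI impI)
  assume "semi_star_operation star"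
  then have "module_colon (star base_domain) I = module_inverse I"
    by (simp add: semi_star_operation_def module_inverse_def)
  then show "quasi_star_invertible star I \<longleftrightarrow> star_invertible star I"
    by (intro quasi_star_invertible_iff_star_invertible[OF assms]) simp
next
  assume "stable_semistar star \<and> finitely_generated I"
  moreover have I: "I \<in> Fbar" using assms(2) by (simp add: nonzero_fractional_ideal_def)
  ultimately have "module_colon (star base_domain) I = star (module_inverse I)"
    by (simp add: stable_star_colon[OF assms(1)] base_domain_Fbar module_inverse_def)
  then have "star (module_prod I (module_colon (star base_domain) I)) =
      star (module_prod I (module_inverse I))"
    using star_module_prod_star[OF assms(1) I module_inverse_Fbar[OF assms(2)]] by simp
  then show "quasi_star_invertible star I \<longleftrightarrow> star_invertible star I"
    by (rule quasi_star_invertible_iff_star_invertible[OF assms])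
qed

end
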